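(* Let $X_1=X_2=X_3=[0,1]$, let each $\mu_{ij}$ be Lebesgue measure on $[0,1]^2$, and $c(x_1,x_2,x_3)=x_1x_2x_3$. Then there exists exactly one probability measure $\pi$ on $[0,1]^3$ with $\mathrm{Pr}_{ij}(\pi)=\mu_{ij}$ for all $1\le i<j\le3$ minimizing $\int x_1x_2x_3\,d\pi$ among all such measures, and its support equals the Sierpiński tetrahedron $S$.
   Context: $\mathrm{Pr}_{ij}$ is the projection of $[0,1]^3$ onto coordinates $(i,j)$. The Sierpiński tetrahedron $S\subseteq[0,1]^3$ is the set of points $(x_1,x_2,x_3)$ for which there exist binary expansions $x_i=\sum_{k\ge1}x_{i,k}2^{-k}$, $x_{i,k}\in\{0,1\}$, such that $x_{1,k}+x_{2,k}+x_{3,k}\equiv0\pmod 2$ for all $k\ge1$. (Equivalently $S=\bigcap_{n\ge1}J_n$ where $J_n$ is the union of the cubes $\prod_{i=1}^3[a_i2^{-n},(a_i+1)2^{-n}]$ over integers $0\le a_i<2^n$ whose bitwise XOR $a_1\oplus a_2\oplus a_3$ is $0$.) *)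

theory Defs
  imports "HOL-Probability.Probability"
begin

type_synonym point3 = "real \<times> real \<times> real"

definition Pr12 :: "point3 \<Rightarrow> real \<times> real" where "Pr12 = (\<lambda>(x1, x2, x3). (x1, x2))"
definition Pr13 :: "point3 \<Rightarrow> real \<times> real" where "Pr13 = (\<lambda>(x1, x2, x3). (x1, x3))"
definition Pr23 :: "point3 \<Rightarrow> real \<times> real" where "Pr23 = (\<lambda>(x1, x2, x3). (x2, x3))"

definition leb_square :: "(real \<times> real) measure" where
  "leb_square = density lborel (indicator ({0..1} \<times> {0..1}))"

definition unit_cube :: "point3 set" where
  "unit_cube = {0..1} \<times> {0..1} \<times> {0..1}"

definition admissible :: "point3 measure \<Rightarrow> bool" where
  "admissible \<pi> \<longleftrightarrow> sets \<pi> = sets (borel :: point3 measure) \<and> prob_space \<pi> \<and>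
     emeasure \<pi> (UNIV - unit_cube) = 0 \<and>
     distr \<pi> borel Pr12 = leb_square \<and>
     distr \<pi> borel Pr13 = leb_square \<and>
     distr \<pi> borel Pr23 = leb_square"

definition cost :: "point3 \<Rightarrow> real" where
  "cost = (\<lambda>(x1, x2, x3). x1 * x2 * x3)"

definition optimal :: "point3 measure \<Rightarrow> bool" where
  "optimal \<pi> \<longleftrightarrow> admissible \<pi> \<and>
     (\<forall>\<sigma>. admissible \<sigma> \<longrightarrow> integral\<^sup>L \<pi> cost \<le> integral\<^sup>L \<sigma> cost)"

definition msupport :: "'a::metric_space measure \<Rightarrow> 'a set" where
  "msupport M = {x. \<forall>e>0. emeasure M (ball x e) > 0}"

text \<open>Sierpinski tetrahedron via binary expansions (digit k here is digit k+1 of the paper).\<close>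
definition sierpinski :: "point3 set" where
  "sierpinski = {(x1, x2, x3). \<exists>a b c :: nat \<Rightarrow> nat.
      (\<forall>k. a k \<in> {0,1} \<and> b k \<in> {0,1} \<and> c k \<in> {0,1} \<and> even (a k + b k + c k)) \<and>
      x1 = (\<Sum>k. real (a k) / 2 ^ Suc k) \<and>
      x2 = (\<Sum>k. real (b k) / 2 ^ Suc k) \<and>
      x3 = (\<Sum>k. real (c k) / 2 ^ Suc k)}"

end

theory Submission
  imports Defs
begin

text \<open>Let \<open>x \<oplus> y\<close> be the bitwise exclusive or. Kantorovich duality certifies that the law of
  \<open>(x, y, x \<oplus> y)\<close>, with \<open>x\<close> and \<open>y\<close> independent and uniform, is optimal: there is a potential \<open>Q\<close>
  such that the gap \<open>x y z - Q x y - Q x z - Q y z\<close> is nonnegative on the cube, and at irrational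
  points it vanishes only if \<open>z = x \<oplus> y\<close>. Doubling all coordinates modulo \<open>1\<close> multiplies the gap by
  \<open>8\<close> if the leading digits have even sum, and otherwise adds a defect such that the gap plus any
  defect is again reproduced up to a nonnegative term; iterating gives both claims. The
  integrals of \<open>Q\<close> depend only on the marginals, so a measure is optimal exactly when it lives on the
  graph of \<open>\<oplus>\<close>, which determines it.\<close>

section \<open>Binary digits and the dual potential\<close>

text \<open>Counting \<open>1/2\<close> as digit 1 gives dyadic points of [0,1) their terminating
  expansion, while 1 is a fixed point of \<open>doubling\<close> with all digits 1. So
  \<open>doubling\<close> maps the closed unit interval into itself.\<close>

definition digit :: "real \<Rightarrow> real" where
  "digit x = (if 1/2 \<le> x then 1 else 0)"

definition doubling :: "real \<Rightarrow> real" where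
  "doubling x = 2 * x - digit x"

lemma digit_cases: "digit x = 0 \<or> digit x = 1"
  by (simp add: digit_def)

lemma doubling_unit: "x \<in> {0..1} \<Longrightarrow> doubling x \<in> {0..1}"
  by (auto simp: doubling_def digit_def)

lemma doubling_iter_unit: "x \<in> {0..1} \<Longrightarrow> (doubling ^^ n) x \<in> {0..1}"
  by (induction n) (use doubling_unit in auto)

lemma eq_half_digit_doubling: "x = (doubling x + digit x) / 2"
  by (simp add: doubling_def)

definition xor_digit :: "real \<Rightarrow> real \<Rightarrow> real" where
  "xor_digit x y = (if digit x = digit y then 0 else 1)"

definition pot_term :: "real \<Rightarrow> real \<Rightarrow> real" where
  "pot_term x y =
    (if digit x = 0 \<and> digit y = 0 then 0
     else if digit x = 1 \<and> digit y = 1 then 1/4 + 3/4 * (doubling x + doubling y)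
     else if digit x = 1 then doubling x * doubling y + doubling y / 2 - 1/8 - 3/4 * doubling x
     else doubling x * doubling y + doubling x / 2 - 1/8 - 3/4 * doubling y)"

text \<open>In closed form, \<open>pot x y = I x y - (I x x + I y y) / 4\<close>, where \<open>I x y\<close> is the integral of the
  bitwise exclusive or over \<open>[0,x] \<times> [0,y]\<close>; \<open>pot_term\<close> comes from splitting these integrals at \<open>1/2\<close>.\<close>

definition pot :: "real \<Rightarrow> real \<Rightarrow> real" where
  "pot x y = (\<Sum>n. pot_term ((doubling ^^ n) x) ((doubling ^^ n) y) / 8 ^ Suc n)"

lemma pot_term_commute: "pot_term x y = pot_term y x"
  using digit_cases[of x] digit_cases[of y] by (auto simp: pot_term_def algebra_simps)

lemma pot_commute: "pot x y = pot y x"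
  unfolding pot_def by (subst pot_term_commute) (rule refl)

lemma pot_term_bound:
  assumes "x \<in> {0..1}" "y \<in> {0..1}"
  shows "\<bar>pot_term x y\<bar> \<le> 2"
proof -
  have s: "0 \<le> doubling x" "doubling x \<le> 1" "0 \<le> doubling y" "doubling y \<le> 1"
    using assms doubling_unit by auto
  \<comment> \<open>Treating the product as a further variable in [0,1] makes all four cases
    linear.\<close>
  define p where "p = doubling x * doubling y"
  have p: "0 \<le> p" "p \<le> 1"
    unfolding p_def using s mult_le_one[of "doubling x" "doubling y"] by auto
  show ?thesis
    using s p unfolding pot_term_def p_def[symmetric] by (auto simp: abs_le_iff field_simps)
qed

section \<open>Series with geometric weights\<close>

lemma geometric_bound:
  fixes f :: "nat \<Rightarrow> real"
  assumes "\<And>n. \<bar>f n\<bar> \<le> B" "r > 1"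
  shows summable_geometric_bound: "summable (\<lambda>n. f n / r ^ Suc n)"
    and suminf_geometric_bound: "\<bar>\<Sum>n. f n / r ^ Suc n\<bar> \<le> B / (r - 1)"
proof -
  have "(\<lambda>n. B / r * (1 / r) ^ n) sums (B / r * (1 / (1 - 1 / r)))"
    by (intro sums_mult geometric_sums) (use assms in auto)
  then have s: "(\<lambda>n. B / r * (1 / r) ^ n) sums (B / (r - 1))"
    using assms(2) by (simp add: field_simps)
  have b: "norm (f n / r ^ Suc n) \<le> B / r * (1 / r) ^ n" for n
    using assms(1)[of n] assms(2) by (auto simp: field_simps)
  show "summable (\<lambda>n. f n / r ^ Suc n)"
    using b by (rule summable_comparison_test'[OF sums_summable[OF s]])
  show "\<bar>\<Sum>n. f n / r ^ Suc n\<bar> \<le> B / (r - 1)"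
    using norm_suminf_le[OF b sums_summable[OF s]] sums_unique[OF s] by simp
qed

text \<open>Source of every recursion below: with \<open>r = 8\<close> for the potential, with
  \<open>r = 2\<close> for binary expansions.\<close>

lemma suminf_geometric_shift:
  fixes f :: "nat \<Rightarrow> real"
  assumes "\<And>n. \<bar>f n\<bar> \<le> B" "r > 1"
  shows "r * (\<Sum>n. f n / r ^ Suc n) = f 0 + (\<Sum>n. f (Suc n) / r ^ Suc n)"
proof -
  have s: "summable (\<lambda>n. f n / r ^ Suc n)" "summable (\<lambda>n. f (Suc n) / r ^ Suc n)"
    using summable_geometric_bound[of f, OF assms]
      summable_geometric_bound[of "\<lambda>n. f (Suc n)", OF assms] by auto
  have "(\<Sum>n. f n / r ^ Suc n) = (\<Sum>n. f (Suc n) / r ^ Suc (Suc n)) + f 0 / r"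
    using suminf_split_head[OF s(1)] by simp
  also have "(\<lambda>n. f (Suc n) / r ^ Suc (Suc n)) = (\<lambda>n. (f (Suc n) / r ^ Suc n) / r)"
    by (simp add: field_simps)
  also have "(\<Sum>n. (f (Suc n) / r ^ Suc n) / r) = (\<Sum>n. f (Suc n) / r ^ Suc n) / r"
    by (rule suminf_divide[OF s(2)])
  finally have "(\<Sum>n. f n / r ^ Suc n) = (\<Sum>n. f (Suc n) / r ^ Suc n) / r + f 0 / r" .
  then show ?thesis
    using assms(2) by (simp add: field_simps del: power_Suc)
qed

text \<open>The factor 8 matches the scaling of \<open>x * y * z\<close> when all three coordinates
  double.\<close>

lemma pot_rec:
  assumes "x \<in> {0..1}" "y \<in> {0..1}"
  shows "8 * pot x y = pot (doubling x) (doubling y) + pot_term x y"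
  using suminf_geometric_shift[of "\<lambda>n. pot_term ((doubling ^^ n) x) ((doubling ^^ n) y)" 2 8]
    pot_term_bound doubling_iter_unit assms
  unfolding pot_def by (simp add: funpow_swap1 del: power_Suc)

lemma pot_bound:
  assumes "x \<in> {0..1}" "y \<in> {0..1}"
  shows "\<bar>pot x y\<bar> \<le> 1"
  using suminf_geometric_bound[of "\<lambda>n. pot_term ((doubling ^^ n) x) ((doubling ^^ n) y)" 2 8]
    pot_term_bound doubling_iter_unit assms
  unfolding pot_def by (fastforce simp del: power_Suc)

section \<open>The gap and its self-similarity\<close>

definition gap :: "real \<Rightarrow> real \<Rightarrow> real \<Rightarrow> real" where
  "gap x y z = x * y * z - pot x y - pot x z - pot y z"

lemma gap_bound:
  assumes "x \<in> {0..1}" "y \<in> {0..1}" "z \<in> {0..1}"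
  shows "\<bar>gap x y z\<bar> \<le> 4"
proof -
  have "0 \<le> x * y * z" "x * y * z \<le> 1"
    using assms by (auto intro!: mult_nonneg_nonneg mult_le_one)
  then show ?thesis
    using pot_bound[OF assms(1,2)] pot_bound[OF assms(1,3)] pot_bound[OF assms(2,3)]
    unfolding gap_def by linarith
qed

text \<open>The remainder for leading digits (1, 0, 0). The first argument belongs to the coordinate
  with digit 1; the other two enter symmetrically.\<close>

definition defect1 :: "real \<Rightarrow> real \<Rightarrow> real \<Rightarrow> real" where
  "defect1 x y z = y * z - x * y - x * z - (y + z) / 2 + 1/4 + 3/2 * x"

definition defect3 :: "real \<Rightarrow> real \<Rightarrow> real \<Rightarrow> real" where
  "defect3 x y z = x * y + x * z + y * z - (x + y + z) / 2 + 1/4"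

text \<open>The error in the self-similarity of the gap when the leading digits are \<open>a\<close>, \<open>b\<close>, \<open>c\<close>
  and the shifted points are \<open>x\<close>, \<open>y\<close>, \<open>z\<close>; it vanishes when \<open>a + b + c\<close> is even.\<close>

definition defect :: "real \<Rightarrow> real \<Rightarrow> real \<Rightarrow> real \<Rightarrow> real \<Rightarrow> real \<Rightarrow> real" where
  "defect a b c x y z =
    (if a + b + c = 1 then
       (if a = 1 then defect1 x y z else if b = 1 then defect1 y x z else defect1 z x y)
     else if a + b + c = 3 then defect3 x y z else 0)"

text \<open>Doubling turns \<open>8 * (x * y * z)\<close> into the product of shifted coordinates
  plus digits. The terms \<open>pot_term\<close> cancel all lower-order terms when the digit sum is
  even, and leave the defect otherwise.\<close>

lemma gap_rec:
  assumes "x \<in> {0..1}" "y \<in> {0..1}" "z \<in> {0..1}"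
  shows "8 * gap x y z = gap (doubling x) (doubling y) (doubling z)
    + defect (digit x) (digit y) (digit z) (doubling x) (doubling y) (doubling z)"
proof -
  define x' y' z' where "x' = doubling x" "y' = doubling y" "z' = doubling z"
  note p = pot_rec[OF assms(1,2)] pot_rec[OF assms(1,3)] pot_rec[OF assms(2,3)]
  have "8 * (x * y * z) = (x' + digit x) * (y' + digit y) * (z' + digit z)"
    unfolding x'_y'_z'_def
    by (subst (1) eq_half_digit_doubling[of x], subst (1) eq_half_digit_doubling[of y],
        subst (1) eq_half_digit_doubling[of z]) simp
  then have "8 * gap x y z = (x' + digit x) * (y' + digit y) * (z' + digit z)
      - (pot x' y' + pot_term x y) - (pot x' z' + pot_term x z) - (pot y' z' + pot_term y z)"
    using p unfolding gap_def x'_y'_z'_def by argo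
  also have "\<dots> = gap x' y' z' + defect (digit x) (digit y) (digit z) x' y' z'"
    using digit_cases[of x] digit_cases[of y] digit_cases[of z]
    unfolding gap_def defect_def defect1_def defect3_def pot_term_def x'_y'_z'_def[symmetric]
    by (elim disjE) (simp_all add: field_simps)
  finally show ?thesis unfolding x'_y'_z'_def .
qed

section \<open>Positivity of the gap\<close>

text \<open>One doubling step can turn the bare gap into the gap plus any of these corrections, so
  lower bounds have to be proved for all of them at once.\<close>

definition defects :: "real \<Rightarrow> real \<Rightarrow> real \<Rightarrow> real set" where
  "defects x y z = {0, defect1 x y z, defect1 y x z, defect1 z x y, defect3 x y z}"

text \<open>For an even digit sum the defect vanishes and \<open>d = 0\<close> serves; for an odd
  one \<open>d\<close> is again \<open>defect3\<close>. The remainder \<open>e\<close> is written in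
  factors that are nonnegative on the cube and positive inside it, so that its sign can be read
  off.\<close>

lemma defect3_step:
  assumes abc: "a = 0 \<or> a = 1" "b = 0 \<or> b = 1" "c = 0 \<or> c = 1"
    and xyz: "x \<in> {0..1}" "y \<in> {0..1}" "z \<in> {0..1}"
  shows "\<exists>d\<in>defects x y z. \<exists>e\<ge>0.
      defect a b c x y z + 8 * defect3 ((x + a) / 2) ((y + b) / 2) ((z + c) / 2) = d + e
      \<and> (x \<in> {0<..<1} \<and> y \<in> {0<..<1} \<and> z \<in> {0<..<1} \<longrightarrow> 0 < e)"
proof -
  have *: ?thesis
    if "d \<in> defects x y z"
      "defect a b c x y z + 8 * defect3 ((x + a) / 2) ((y + b) / 2) ((z + c) / 2) = d + e"
      "0 \<le> e" "x \<in> {0<..<1} \<Longrightarrow> y \<in> {0<..<1} \<Longrightarrow> z \<in> {0<..<1} \<Longrightarrow> 0 < e" for d e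
    using that by blast
  note pos = add_nonneg_nonneg add_pos_pos mult_nonneg_nonneg mult_pos_pos
  note defs = defects_def defect_def defect1_def defect3_def
  consider "a = 0" "b = 0" "c = 0"
    | "a = 1" "b = 0" "c = 0"
    | "a = 0" "b = 1" "c = 0"
    | "a = 0" "b = 0" "c = 1"
    | "a = 1" "b = 1" "c = 0"
    | "a = 1" "b = 0" "c = 1"
    | "a = 0" "b = 1" "c = 1"
    | "a = 1" "b = 1" "c = 1"
    using abc by blast
  then show ?thesis
  proof cases
    case 1
    then show ?thesis
      by (intro *[of "0" "2 * ((1 - x) * (1 - y) * (1 - z) + x * y * z)"], simp add: defs,
          (simp add: defs field_simps; fail | simp add: defs), (intro pos; use xyz in auto)+)
  next
    case 2
    then show ?thesis
      by (intro *[of "defect3 x y z" "2 * (y * z)"], simp add: defs,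
          (simp add: defs field_simps; fail | simp add: defs), (intro pos; use xyz in auto)+)
  next
    case 3
    then show ?thesis
      by (intro *[of "defect3 x y z" "2 * (x * z)"], simp add: defs,
          (simp add: defs field_simps; fail | simp add: defs), (intro pos; use xyz in auto)+)
  next
    case 4
    then show ?thesis
      by (intro *[of "defect3 x y z" "2 * (x * y)"], simp add: defs,
          (simp add: defs field_simps; fail | simp add: defs), (intro pos; use xyz in auto)+)
  next
    case 5
    then show ?thesis
      by (intro *[of "0" "2 * (x * y + x * z + y * z + z)"], simp add: defs,
          (simp add: defs field_simps; fail | simp add: defs), (intro pos; use xyz in auto)+)
  next
    case 6
    then show ?thesis
      by (intro *[of "0" "2 * (x * y + x * z + y * z + y)"], simp add: defs,
          (simp add: defs field_simps; fail | simp add: defs), (intro pos; use xyz in auto)+)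
  next
    case 7
    then show ?thesis
      by (intro *[of "0" "2 * (x * y + x * z + y * z + x)"], simp add: defs,
          (simp add: defs field_simps; fail | simp add: defs), (intro pos; use xyz in auto)+)
  next
    case 8
    then show ?thesis
      by (intro *[of "defect3 x y z" "2 * (x * y + x * z + y * z + x + y + z + 1)"], simp add: defs,
          (simp add: defs field_simps; fail | simp add: defs), (intro pos; use xyz in auto)+)
  qed
qed

text \<open>The same pattern: \<open>d = 0\<close> for an even digit sum and
  \<open>d = defect1 x y z\<close> for an odd one, whichever coordinates carry the digit 1. The
  remainders now also use \<open>1 - y\<close>, \<open>2 - y\<close> and their analogues in
  \<open>z\<close>.\<close>

lemma defect1_step:
  assumes abc: "a = 0 \<or> a = 1" "b = 0 \<or> b = 1" "c = 0 \<or> c = 1"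
    and xyz: "x \<in> {0..1}" "y \<in> {0..1}" "z \<in> {0..1}"
  shows "\<exists>d\<in>defects x y z. \<exists>e\<ge>0.
      defect a b c x y z + 8 * defect1 ((x + a) / 2) ((y + b) / 2) ((z + c) / 2) = d + e
      \<and> (x \<in> {0<..<1} \<and> y \<in> {0<..<1} \<and> z \<in> {0<..<1} \<longrightarrow> 0 < e)"
proof -
  have *: ?thesis
    if "d \<in> defects x y z"
      "defect a b c x y z + 8 * defect1 ((x + a) / 2) ((y + b) / 2) ((z + c) / 2) = d + e"
      "0 \<le> e" "x \<in> {0<..<1} \<Longrightarrow> y \<in> {0<..<1} \<Longrightarrow> z \<in> {0<..<1} \<Longrightarrow> 0 < e" for d e
    using that by blast
  note pos = add_nonneg_nonneg add_pos_pos mult_nonneg_nonneg mult_pos_pos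
  note defs = defects_def defect_def defect1_def defect3_def
  consider "a = 0" "b = 0" "c = 0"
    | "a = 1" "b = 0" "c = 0"
    | "a = 0" "b = 1" "c = 0"
    | "a = 0" "b = 0" "c = 1"
    | "a = 1" "b = 1" "c = 0"
    | "a = 1" "b = 0" "c = 1"
    | "a = 0" "b = 1" "c = 1"
    | "a = 1" "b = 1" "c = 1"
    using abc by blast
  then show ?thesis
  proof cases
    case 1
    then show ?thesis
      by (intro *[of "0" "2 * ((1 - y) * (1 - z) + x * (1 + (1 - y) + (1 - z)))"], simp add: defs,
          (simp add: defs field_simps; fail | simp add: defs), (intro pos; use xyz in auto)+)
  next
    case 2
    then show ?thesis
      by (intro *[of "defect1 x y z" "2 * ((2 - y) * (2 - z) + x * (1 + (1 - y) + (1 - z)))"], simp add: defs,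
          (simp add: defs field_simps; fail | simp add: defs), (intro pos; use xyz in auto)+)
  next
    case 3
    then show ?thesis
      by (intro *[of "defect1 x y z" "2 * (x * (1 - y))"], simp add: defs,
          (simp add: defs field_simps; fail | simp add: defs), (intro pos; use xyz in auto)+)
  next
    case 4
    then show ?thesis
      by (intro *[of "defect1 x y z" "2 * (x * (1 - z))"], simp add: defs,
          (simp add: defs field_simps; fail | simp add: defs), (intro pos; use xyz in auto)+)
  next
    case 5
    then show ?thesis
      by (intro *[of "0" "2 * ((1 - y) * (2 - z) + x * ((1 - y) + (1 - z)))"], simp add: defs,
          (simp add: defs field_simps; fail | simp add: defs), (intro pos; use xyz in auto)+)
  next
    case 6
    then show ?thesis
      by (intro *[of "0" "2 * ((2 - y) * (1 - z) + x * ((1 - y) + (1 - z)))"], simp add: defs,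
          (simp add: defs field_simps; fail | simp add: defs), (intro pos; use xyz in auto)+)
  next
    case 7
    then show ?thesis
      by (intro *[of "0" "2 * (x * ((1 - y) * (1 - z)) + y * z * (1 - x))"], simp add: defs,
          (simp add: defs field_simps; fail | simp add: defs), (intro pos; use xyz in auto)+)
  next
    case 8
    then show ?thesis
      by (intro *[of "defect1 x y z" "2 * ((1 - y) * (1 - z))"], simp add: defs,
          (simp add: defs field_simps; fail | simp add: defs), (intro pos; use xyz in auto)+)
  qed
qed

text \<open>With \<open>gap_rotate\<close>, this reduces the variants of \<open>defect1\<close> for
  the second and third coordinate to the one for the first.\<close>

lemma gap_swap: "gap y x z = gap x y z"
  by (simp add: gap_def pot_commute[of y x] mult.commute)

lemma gap_rotate: "gap z x y = gap x y z"
  by (simp add: gap_def pot_commute[of z] mult_ac)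

lemma defect_in_defects:
  "defect (digit a) (digit b) (digit c) x y z \<in> defects x y z"
  by (auto simp: defect_def defects_def)

lemma gap_defect3_rec:
  assumes "x \<in> {0..1}" "y \<in> {0..1}" "z \<in> {0..1}"
  shows "\<exists>d\<in>defects (doubling x) (doubling y) (doubling z). \<exists>e\<ge>0.
      8 * (gap x y z + defect3 x y z) = gap (doubling x) (doubling y) (doubling z) + d + e
      \<and> (doubling x \<in> {0<..<1} \<and> doubling y \<in> {0<..<1} \<and> doubling z \<in> {0<..<1} \<longrightarrow> 0 < e)"
proof -
  have "8 * (gap x y z + defect3 x y z) = gap (doubling x) (doubling y) (doubling z)
    + (defect (digit x) (digit y) (digit z) (doubling x) (doubling y) (doubling z)
    + 8 * defect3 ((doubling x + digit x) / 2) ((doubling y + digit y) / 2) ((doubling z + digit z) / 2))"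
    using gap_rec[OF assms] unfolding eq_half_digit_doubling[symmetric] by simp
  then show ?thesis
    using defect3_step[OF digit_cases digit_cases digit_cases assms[THEN doubling_unit], of x y z]
    by (auto simp: add.assoc)
qed

lemma gap_defect1_rec:
  assumes "x \<in> {0..1}" "y \<in> {0..1}" "z \<in> {0..1}"
  shows "\<exists>d\<in>defects (doubling x) (doubling y) (doubling z). \<exists>e\<ge>0.
      8 * (gap x y z + defect1 x y z) = gap (doubling x) (doubling y) (doubling z) + d + e
      \<and> (doubling x \<in> {0<..<1} \<and> doubling y \<in> {0<..<1} \<and> doubling z \<in> {0<..<1} \<longrightarrow> 0 < e)"
proof -
  have "8 * (gap x y z + defect1 x y z) = gap (doubling x) (doubling y) (doubling z)
    + (defect (digit x) (digit y) (digit z) (doubling x) (doubling y) (doubling z)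
    + 8 * defect1 ((doubling x + digit x) / 2) ((doubling y + digit y) / 2) ((doubling z + digit z) / 2))"
    using gap_rec[OF assms] unfolding eq_half_digit_doubling[symmetric] by simp
  then show ?thesis
    using defect1_step[OF digit_cases digit_cases digit_cases assms[THEN doubling_unit], of x y z]
    by (auto simp: add.assoc)
qed

lemma defects_bound:
  assumes "x \<in> {0..1}" "y \<in> {0..1}" "z \<in> {0..1}" "d \<in> defects x y z"
  shows "-4 \<le> d"
proof -
  have "0 \<le> x * y" "x * y \<le> 1" "0 \<le> x * z" "x * z \<le> 1" "0 \<le> y * z" "y * z \<le> 1"
    using assms by (auto intro: mult_le_one)
  moreover have "0 \<le> x" "x \<le> 1" "0 \<le> y" "y \<le> 1" "0 \<le> z" "z \<le> 1"
    using assms by auto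
  ultimately have "-4 \<le> defect1 x y z" "-4 \<le> defect1 y x z" "-4 \<le> defect1 z x y" "-4 \<le> defect3 x y z"
    unfolding defect1_def defect3_def mult.commute[of y x] mult.commute[of z] by argo+
  then show ?thesis
    using assms(4) by (auto simp: defects_def)
qed

text \<open>The gap and its corrections by the defects reproduce each other, up to nonnegative terms,
  when scaled by \<open>8\<close>, so a uniform lower bound \<open>-B\<close> for all of them improves to \<open>-B / 8\<close>.\<close>

lemma gap_defects_lower_bound:
  assumes "x \<in> {0..1}" "y \<in> {0..1}" "z \<in> {0..1}" "d \<in> defects x y z"
  shows "- (8 / 8 ^ n) \<le> gap x y z + d"
  using assms
proof (induction n arbitrary: x y z d)
  case 0
  then show ?case
    \<comment> \<open>The gap and the correction are each at least -4, hence the initial constant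
      8.\<close>
    using gap_bound[of x y z] defects_bound[of x y z d] by auto
next
  case (Suc n)
  have IH: "- (8 / 8 ^ n) \<le> gap (doubling x) (doubling y) (doubling z) + d"
    if "x \<in> {0..1}" "y \<in> {0..1}" "z \<in> {0..1}" "d \<in> defects (doubling x) (doubling y) (doubling z)"
    for x y z d
    using Suc.IH that doubling_unit by blast
  have 0: "- (8 / 8 ^ Suc n) \<le> gap x y z + 0"
    using IH[OF Suc.prems(1-3) defect_in_defects[of x y z]] gap_rec[OF Suc.prems(1-3)] by simp
  have 3: "- (8 / 8 ^ Suc n) \<le> gap x y z + defect3 x y z"
    using gap_defect3_rec[OF Suc.prems(1-3)] IH[OF Suc.prems(1-3)] by fastforce
  have 1: "- (8 / 8 ^ Suc n) \<le> gap x y z + defect1 x y z"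
    if "x \<in> {0..1}" "y \<in> {0..1}" "z \<in> {0..1}" for x y z
    using gap_defect1_rec[OF that] IH[OF that] by fastforce
  show ?case
    using Suc.prems 0 3 1[of x y z] 1[of y x z] 1[of z x y]
    unfolding defects_def gap_swap[of y x z] gap_rotate[of z x y] by blast
qed

lemma gap_defects_nonneg:
  assumes "x \<in> {0..1}" "y \<in> {0..1}" "z \<in> {0..1}" "d \<in> defects x y z"
  shows "0 \<le> gap x y z + d"
proof (rule LIMSEQ_le_const2)
  show "(\<lambda>n. - (8 * (1 / 8) ^ n)) \<longlonglongrightarrow> (0::real)"
    by real_asymp
  show "\<exists>N. \<forall>n\<ge>N. - (8 * (1 / 8) ^ n) \<le> gap x y z + d"
    using gap_defects_lower_bound[OF assms] by (simp add: power_divide)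
qed

lemma gap_nonneg:
  assumes "x \<in> {0..1}" "y \<in> {0..1}" "z \<in> {0..1}"
  shows "0 \<le> gap x y z"
  using gap_defects_nonneg[OF assms, of 0] by (simp add: defects_def)

section \<open>Zeros of the gap at irrational points\<close>

lemma doubling_irrational: "x \<notin> \<rat> \<Longrightarrow> doubling x \<notin> \<rat>"
proof
  assume "doubling x \<in> \<rat>" "x \<notin> \<rat>"
  moreover have "digit x \<in> \<rat>" by (simp add: digit_def)
  ultimately have "(doubling x + digit x) / 2 \<in> \<rat>" by (intro Rats_divide Rats_add) auto
  with \<open>x \<notin> \<rat>\<close> show False by (simp flip: eq_half_digit_doubling)
qed

lemma irrational_interior: "x \<in> {0..1} \<Longrightarrow> x \<notin> \<rat> \<Longrightarrow> x \<in> {0<..<1::real}"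
  by (metis Rats_0 Rats_1 atLeastAtMost_iff greaterThanLessThan_iff less_eq_real_def)

text \<open>One doubling step suffices: irrational points stay irrational, hence interior, so the
  remainder \<open>e\<close> is strictly positive, and what it is added to is nonnegative.\<close>

lemma gap_defect_pos:
  assumes "x \<in> {0..1} - \<rat>" "y \<in> {0..1} - \<rat>" "z \<in> {0..1} - \<rat>"
  shows "0 < gap x y z + defect1 x y z" "0 < gap x y z + defect3 x y z"
proof -
  have u: "x \<in> {0..1}" "y \<in> {0..1}" "z \<in> {0..1}"
    using assms by auto
  have i: "doubling x \<in> {0<..<1}" "doubling y \<in> {0<..<1}" "doubling z \<in> {0<..<1}"
    using assms doubling_irrational doubling_unit irrational_interior by blast+
  note n = gap_defects_nonneg[OF u[THEN doubling_unit]]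
  show "0 < gap x y z + defect1 x y z"
    using gap_defect1_rec[OF u] i n by fastforce
  show "0 < gap x y z + defect3 x y z"
    using gap_defect3_rec[OF u] i n by fastforce
qed

text \<open>An odd digit sum would make the right-hand side of \<open>gap_rec\<close> strictly
  positive. So the digit sum is even, the defect is 0, and the doubled point is again a
  zero.\<close>

lemma gap_zero_digits:
  assumes "x \<in> {0..1} - \<rat>" "y \<in> {0..1} - \<rat>" "z \<in> {0..1} - \<rat>" "gap x y z = 0"
  shows "digit z = xor_digit x y \<and> gap (doubling x) (doubling y) (doubling z) = 0"
proof -
  define x' y' z' where "x' = doubling x" "y' = doubling y" "z' = doubling z"
  have "x' \<in> {0..1} - \<rat>" "y' \<in> {0..1} - \<rat>" "z' \<in> {0..1} - \<rat>"
    using assms doubling_irrational doubling_unit unfolding x'_y'_z'_def by blast+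
  then have "0 < gap x' y' z' + defect1 x' y' z'" "0 < gap x' y' z' + defect1 y' x' z'"
    "0 < gap x' y' z' + defect1 z' x' y'" "0 < gap x' y' z' + defect3 x' y' z'"
    using gap_defect_pos[of x' y' z'] gap_defect_pos(1)[of y' x' z'] gap_defect_pos(1)[of z' x' y']
    unfolding gap_swap[of y' x' z'] gap_rotate[of z' x' y'] by blast+
  moreover have "gap x' y' z' + defect (digit x) (digit y) (digit z) x' y' z' = 0"
    using gap_rec[of x y z] assms unfolding x'_y'_z'_def by auto
  ultimately show ?thesis
    using digit_cases[of x] digit_cases[of y] digit_cases[of z]
    unfolding defect_def xor_digit_def x'_y'_z'_def[symmetric] by auto
qed

lemma gap_even_digits:
  assumes "x \<in> {0..1}" "y \<in> {0..1}" "z \<in> {0..1}" "digit z = xor_digit x y"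
  shows "gap x y z = gap (doubling x) (doubling y) (doubling z) / 8"
  using gap_rec[OF assms(1-3)] assms(4) digit_cases[of x] digit_cases[of y]
  unfolding defect_def xor_digit_def by auto

section \<open>The exclusive or preserves the uniform measure\<close>

definition bitxor :: "real \<Rightarrow> real \<Rightarrow> real" where
  "bitxor x y = (\<Sum>n. xor_digit ((doubling ^^ n) x) ((doubling ^^ n) y) / 2 ^ Suc n)"

lemma xor_digit_bound: "\<bar>xor_digit x y\<bar> \<le> 1"
  by (simp add: xor_digit_def)

lemma bitxor_commute: "bitxor x y = bitxor y x"
  by (simp add: bitxor_def xor_digit_def eq_commute)

lemma bitxor_rec: "bitxor x y = (bitxor (doubling x) (doubling y) + xor_digit x y) / 2"
  using suminf_geometric_shift[of "\<lambda>n. xor_digit ((doubling ^^ n) x) ((doubling ^^ n) y)" 1 2,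
      OF xor_digit_bound]
  unfolding bitxor_def by (simp add: funpow_swap1 del: power_Suc)

lemma bitxor_unit: "bitxor x y \<in> {0..1}"
proof -
  note b = geometric_bound[of "\<lambda>n. xor_digit ((doubling ^^ n) x) ((doubling ^^ n) y)" 1 2,
      OF xor_digit_bound]
  have "0 \<le> bitxor x y"
    unfolding bitxor_def using b(1) by (intro suminf_nonneg) (auto simp: xor_digit_def)
  then show ?thesis
    using b(2) unfolding bitxor_def by simp
qed

text \<open>Uniqueness by contraction: along the orbit of \<open>h\<close> the bounded difference is
  halved at each step, so it is at most \<open>B / 2 ^ n\<close> for every \<open>n\<close>.\<close>

lemma eq_if_halving:
  fixes f g :: "'a \<Rightarrow> real"
  assumes "\<And>s. P s \<Longrightarrow> \<bar>f s - g s\<bar> \<le> B"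
    and "\<And>s. P s \<Longrightarrow> P (h s) \<and> \<bar>f s - g s\<bar> \<le> \<bar>f (h s) - g (h s)\<bar> / 2"
    and "P s"
  shows "f s = g s"
proof -
  have "\<bar>f s - g s\<bar> \<le> B * (1 / 2) ^ n" for n
    using assms(3)
  proof (induction n arbitrary: s)
    case 0
    then show ?case using assms(1) by simp
  next
    case (Suc n)
    have "\<bar>f s - g s\<bar> \<le> \<bar>f (h s) - g (h s)\<bar> / 2" "\<bar>f (h s) - g (h s)\<bar> \<le> B * (1 / 2) ^ n"
      using assms(2)[OF Suc.prems] Suc.IH[of "h s"] by simp_all
    then show ?case by simp
  qed
  then have "\<bar>f s - g s\<bar> \<le> 0"
    by (intro LIMSEQ_le_const[of "\<lambda>n. B * (1 / 2) ^ n"]) (auto intro!: tendsto_mult_right_zero LIMSEQ_power_zero)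
  then show ?thesis by simp
qed

text \<open>At zeros of the gap, \<open>z\<close> obeys the same halving recursion as
  \<open>bitxor x y\<close>, since its leading digit is the exclusive or of the other two and
  doubling leads to another zero.\<close>

lemma gap_zero_imp_bitxor:
  assumes "x \<in> {0..1} - \<rat>" "y \<in> {0..1} - \<rat>" "z \<in> {0..1} - \<rat>" "gap x y z = 0"
  shows "z = bitxor x y"
proof -
  let ?P = "\<lambda>(x, y, z). x \<in> {0..1} - \<rat> \<and> y \<in> {0..1} - \<rat> \<and> z \<in> {0..1} - \<rat> \<and> gap x y z = 0"
  let ?f = "\<lambda>(x, y, z). z :: real" and ?g = "\<lambda>(x, y, z). bitxor x y"
  let ?h = "\<lambda>(x, y, z). (doubling x, doubling y, doubling z)"
  have "?f (x, y, z) = ?g (x, y, z)"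
  proof (rule eq_if_halving[where P = ?P and h = ?h and B = 1])
    fix s assume "?P s"
    then obtain x y z where s: "s = (x, y, z)" and P: "?P (x, y, z)"
      by (cases s) auto
    show "\<bar>?f s - ?g s\<bar> \<le> 1"
      using bitxor_unit[of x y] P by (auto simp: s)
    have d: "digit z = xor_digit x y" "gap (doubling x) (doubling y) (doubling z) = 0"
      using gap_zero_digits P by auto
    have "z - bitxor x y = (doubling z - bitxor (doubling x) (doubling y)) / 2"
      using bitxor_rec[of x y] eq_half_digit_doubling[of z] d(1) by argo
    then have "\<bar>z - bitxor x y\<bar> = \<bar>doubling z - bitxor (doubling x) (doubling y)\<bar> / 2"
      by (simp only: abs_divide abs_numeral)
    then show "?P (?h s) \<and> \<bar>?f s - ?g s\<bar> \<le> \<bar>?f (?h s) - ?g (?h s)\<bar> / 2"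
      using P d doubling_unit doubling_irrational by (simp add: s)
  qed (use assms in auto)
  then show ?thesis by simp
qed

lemma bitxor_half:
  assumes "y \<in> {0..<1}"
  shows "bitxor x (y / 2) = (bitxor (doubling x) y + digit x) / 2"
    and "bitxor x ((y + 1) / 2) = (bitxor (doubling x) y + (1 - digit x)) / 2"
proof -
  \<comment> \<open>The value \<open>y = 1\<close> is excluded because \<open>1/2\<close> has digit
    1.\<close>
  have "digit (y / 2) = 0" "doubling (y / 2) = y"
    "digit ((y + 1) / 2) = 1" "doubling ((y + 1) / 2) = y"
    using assms by (auto simp: digit_def doubling_def field_simps)
  then show "bitxor x (y / 2) = (bitxor (doubling x) y + digit x) / 2"
    "bitxor x ((y + 1) / 2) = (bitxor (doubling x) y + (1 - digit x)) / 2"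
    using bitxor_rec[of x "y / 2"] bitxor_rec[of x "(y + 1) / 2"] digit_cases[of x]
    by (auto simp: xor_digit_def)
qed

lemma bitxor_0:
  assumes "y \<in> {0..1}"
  shows "bitxor 0 y = y"
proof (rule eq_if_halving[where P = "\<lambda>y. y \<in> {0..1}" and h = doubling and B = 1])
  fix y :: real assume y: "y \<in> {0..1}"
  show "\<bar>bitxor 0 y - y\<bar> \<le> 1"
    using bitxor_unit[of 0 y] y by auto
  have "digit 0 = 0" "doubling 0 = 0"
    by (auto simp: digit_def doubling_def)
  then have "bitxor 0 y - y = (bitxor 0 (doubling y) - doubling y) / 2"
    using bitxor_rec[of 0 y] eq_half_digit_doubling[of y] digit_cases[of y]
    by (auto simp: xor_digit_def)
  then have "\<bar>bitxor 0 y - y\<bar> = \<bar>bitxor 0 (doubling y) - doubling y\<bar> / 2"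
    by (simp only: abs_divide abs_numeral)
  then show "doubling y \<in> {0..1} \<and> \<bar>bitxor 0 y - y\<bar> \<le> \<bar>bitxor 0 (doubling y) - doubling y\<bar> / 2"
    using doubling_unit[OF y] by simp
qed (rule assms)

section \<open>Measurability\<close>

lemma measurable_digit [measurable]: "digit \<in> borel_measurable borel"
  unfolding digit_def by measurable

lemma measurable_doubling [measurable]: "doubling \<in> borel_measurable borel"
  unfolding doubling_def by measurable

lemma measurable_doubling_iter:
  "f \<in> borel_measurable M \<Longrightarrow> (\<lambda>w. (doubling ^^ n) (f w)) \<in> borel_measurable M"
  by (induction n) (auto intro: measurable_compose[OF _ measurable_doubling])

lemma measurable_bitxor [measurable]:
  assumes "f \<in> borel_measurable M" "g \<in> borel_measurable M"
  shows "(\<lambda>w. bitxor (f w) (g w)) \<in> borel_measurable M"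
  proof -
  note [measurable] = assms[THEN measurable_doubling_iter]
  show ?thesis unfolding bitxor_def xor_digit_def by measurable
qed

lemma measurable_bitxor_right [measurable]: "bitxor x \<in> borel_measurable borel"
  by (rule measurable_bitxor) auto

lemma measurable_pot [measurable]:
  assumes "f \<in> borel_measurable M" "g \<in> borel_measurable M"
  shows "(\<lambda>w. pot (f w) (g w)) \<in> borel_measurable M"
  proof -
  note [measurable] = assms[THEN measurable_doubling_iter]
  show ?thesis unfolding pot_def pot_term_def by measurable
qed

section \<open>The law of the exclusive or on the interval\<close>

abbreviation unif :: "real measure" where
  "unif \<equiv> density lborel (indicator {0..1})"

lemma prob_space_unif: "prob_space unif"
  by (intro prob_spaceI) (simp add: emeasure_density)

lemma AE_unif: "AE y in unif. y \<in> {0..<1}"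
proof -
  have "AE y in lborel. y \<noteq> (1::real)"
    by (rule AE_lborel_singleton)
  then show ?thesis
    by (simp add: AE_density) (auto simp: indicator_def)
qed

text \<open>A uniform point has a fair leading digit and, independently of it, a uniform
  remainder.\<close>

lemma integral_unif_halves:
  fixes f :: "real \<Rightarrow> complex"
  assumes [measurable]: "f \<in> borel_measurable borel" and B: "\<And>x. norm (f x) \<le> B"
  shows "integral\<^sup>L unif f = ((LINT y|unif. f (y / 2)) + (LINT y|unif. f ((y + 1) / 2))) / 2"
proof -
  have U: "integral\<^sup>L unif g = (LINT y|lborel. indicator {0..1} y *\<^sub>R g y)"
    if [measurable]: "g \<in> borel_measurable borel" for g :: "real \<Rightarrow> complex"
    using integral_density[of g lborel "indicator {0..1}"]
    by (simp add: ennreal_indicator)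
  have i: "integrable lborel (\<lambda>y. indicator {a..b} y *\<^sub>R f y)" for a b
    by (rule integrableI_bounded_set_indicator[where B = B]) (use B in \<open>auto simp: emeasure_lborel_Icc_eq\<close>)
  have "integral\<^sup>L unif f = (LINT y|lborel. indicator {0..1/2} y *\<^sub>R f y + indicator {1/2..1} y *\<^sub>R f y)"
    unfolding U[OF assms(1)]
  proof (rule integral_cong_AE)
    \<comment> \<open>The two closed halves overlap only in the null set
      \<open>{1/2}\<close>.\<close>
    show "AE y in lborel. indicator {0..1} y *\<^sub>R f y
        = indicator {0..1/2} y *\<^sub>R f y + indicator {1/2..1} y *\<^sub>R f y"
      using AE_lborel_singleton[of "1/2 :: real"]
      by eventually_elim (auto simp: indicator_def)
  qed measurable
  also have "\<dots> = (LINT y|lborel. indicator {0..1/2} y *\<^sub>R f y) + (LINT y|lborel. indicator {1/2..1} y *\<^sub>R f y)"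
    by (intro Bochner_Integration.integral_add i)
  also have "(LINT y|lborel. indicator {0..1/2} y *\<^sub>R f y) = (LINT y|unif. f (y / 2)) / 2"
    by (subst lborel_integral_real_affine[where c = "1/2" and t = 0], simp, subst U)
      (auto simp: indicator_def scaleR_conv_of_real intro!: Bochner_Integration.integral_cong)
  also have "(LINT y|lborel. indicator {1/2..1} y *\<^sub>R f y) = (LINT y|unif. f ((y + 1) / 2)) / 2"
    by (subst lborel_integral_real_affine[where c = "1/2" and t = "1/2"], simp, subst U)
      (auto simp: indicator_def scaleR_conv_of_real add_divide_distrib add.commute intro!: Bochner_Integration.integral_cong)
  finally show ?thesis by (simp add: add_divide_distrib)
qed

text \<open>As the leading digit of \<open>y\<close> is fair, so is its exclusive or with
  \<open>digit x\<close>. Whatever that digit is, the two halves contribute the factors 1 and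
  \<open>iexp (t / 2)\<close>.\<close>

lemma char_bitxor_rec:
  "char (distr unif borel (bitxor x)) t
    = (1 + iexp (t / 2)) / 2 * char (distr unif borel (bitxor (doubling x))) (t / 2)"
proof -
  let ?e = "\<lambda>x t y. iexp (t * bitxor x y)"
  have c: "char (distr unif borel (bitxor x)) t = integral\<^sup>L unif (?e x t)" for x t
    unfolding char_def by (subst integral_distr) auto
  have "integral\<^sup>L unif (?e x t) = ((LINT y|unif. ?e x t (y / 2)) + (LINT y|unif. ?e x t ((y + 1) / 2))) / 2"
    by (rule integral_unif_halves[where B = 1]) auto
  also have "(LINT y|unif. ?e x t (y / 2)) = (LINT y|unif. iexp (t / 2 * digit x) * ?e (doubling x) (t / 2) y)"
    by (rule integral_cong_AE, measurable, use AE_unif in eventually_elim)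
      (simp only: bitxor_half, simp add: exp_add[symmetric] algebra_simps add_divide_distrib diff_divide_distrib)
  also have "(LINT y|unif. ?e x t ((y + 1) / 2)) = (LINT y|unif. iexp (t / 2 * (1 - digit x)) * ?e (doubling x) (t / 2) y)"
    by (rule integral_cong_AE, measurable, use AE_unif in eventually_elim)
      (simp only: bitxor_half, simp add: exp_add[symmetric] algebra_simps add_divide_distrib diff_divide_distrib)
  finally show ?thesis
    unfolding c using digit_cases[of x] by (auto simp: algebra_simps)
qed

text \<open>A bound uniform in \<open>x\<close>, as \<open>bitxor x\<close> takes values in [0,1].
  It starts the comparison of characteristic functions, whose arguments shrink to 0 under
  halving.\<close>

lemma char_bitxor_bound:
  "cmod (char (distr unif borel (bitxor x)) t - 1) \<le> \<bar>t\<bar>"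
proof -
  interpret prob_space unif by (rule prob_space_unif)
  have i: "integrable unif (\<lambda>y. iexp (t * bitxor x y))"
    by (rule integrable_const_bound[where B = 1]) auto
  have b: "norm (iexp (t * bitxor x y) - 1) \<le> \<bar>t\<bar>" for y
    using iexp_approx1[of "t * bitxor x y" 0] bitxor_unit[of x y]
      mult_left_mono[of "bitxor x y" 1 "\<bar>t\<bar>"] by (simp add: abs_mult)
  have "char (distr unif borel (bitxor x)) t - 1 = (LINT y|unif. iexp (t * bitxor x y) - 1)"
    unfolding char_def
    by (subst integral_distr, simp, simp, subst Bochner_Integration.integral_diff[OF i])
      (use prob_space in simp_all)
  also have "norm \<dots> \<le> (LINT y|unif. norm (iexp (t * bitxor x y) - 1))"
    by (rule integral_norm_bound)
  also have "\<dots> \<le> \<bar>t\<bar>"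
    by (rule integral_le_const) (use i b in auto)
  finally show ?thesis .
qed

text \<open>The characteristic functions \<open>\<phi>\<^sub>x\<close> of \<open>bitxor x\<close> satisfy a recursion that halves the argument and
  whose factor does not depend on \<open>x\<close>; hence all agree with that of \<open>bitxor 0\<close>, the identity.\<close>

lemma distr_bitxor: "distr unif borel (bitxor x) = unif"
proof -
  interpret prob_space unif by (rule prob_space_unif)
  have r: "real_distribution (distr unif borel (bitxor x))" for x
    by (rule real_distribution_distr) simp
  have d: "cmod (char (distr unif borel (bitxor x)) t - char (distr unif borel (bitxor 0)) t) \<le> 2 * \<bar>t\<bar> * (1 / 2) ^ n"
    for n t
  proof (induction n arbitrary: x t)
    case 0
    then show ?case
      using norm_triangle_ineq4[of "char (distr unif borel (bitxor x)) t - 1" "char (distr unif borel (bitxor 0)) t - 1"]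
        char_bitxor_bound[of x t] char_bitxor_bound[of 0 t] by simp
  next
    case (Suc n)
    \<comment> \<open>Since 0 is fixed by \<open>doubling\<close>, the reference law of
      \<open>bitxor 0\<close> recurs to itself.\<close>
    have "doubling 0 = 0" by (simp add: doubling_def digit_def)
    then have "char (distr unif borel (bitxor x)) t - char (distr unif borel (bitxor 0)) t
      = (1 + iexp (t / 2)) / 2 * (char (distr unif borel (bitxor (doubling x))) (t / 2)
        - char (distr unif borel (bitxor 0)) (t / 2))"
      using char_bitxor_rec[of x t] char_bitxor_rec[of 0 t] by (simp only: right_diff_distrib)
    then have "cmod (char (distr unif borel (bitxor x)) t - char (distr unif borel (bitxor 0)) t)
      = cmod ((1 + iexp (t / 2)) / 2) * cmod (char (distr unif borel (bitxor (doubling x))) (t / 2)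
        - char (distr unif borel (bitxor 0)) (t / 2))"
      by (simp only: norm_mult)
    also have "\<dots> \<le> 1 * cmod (char (distr unif borel (bitxor (doubling x))) (t / 2)
        - char (distr unif borel (bitxor 0)) (t / 2))"
      using norm_triangle_ineq[of 1 "iexp (t / 2)"]
      by (intro mult_right_mono) (simp_all add: norm_divide)
    also have "\<dots> \<le> 2 * \<bar>t\<bar> * (1 / 2) ^ Suc n"
      using Suc.IH[of "doubling x" "t / 2"] by simp
    finally show ?case .
  qed
  have "cmod (char (distr unif borel (bitxor x)) t - char (distr unif borel (bitxor 0)) t) \<le> 0" for t
    by (rule LIMSEQ_le_const[of "\<lambda>n. 2 * \<bar>t\<bar> * (1 / 2) ^ n"])
      (use d in \<open>auto intro!: tendsto_mult_right_zero LIMSEQ_power_zero\<close>)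
  then have "char (distr unif borel (bitxor x)) = char (distr unif borel (bitxor 0))"
    by (intro ext) simp
  then have "distr unif borel (bitxor x) = distr unif borel (bitxor 0)"
    by (rule Levy_uniqueness[OF r r])
  also have "\<dots> = distr unif borel (\<lambda>y. y)"
    by (rule distr_cong_AE, simp, simp, use AE_unif in eventually_elim) (auto simp: bitxor_0)
  also have "\<dots> = unif"
    by (rule distr_id2) simp
  finally show ?thesis .
qed

section \<open>Lebesgue measure on the square\<close>

lemma leb_square_eq: "leb_square = unif \<Otimes>\<^sub>M unif"
proof -
  interpret prob_space unif by (rule prob_space_unif)
  have "unif \<Otimes>\<^sub>M unif = density (lborel \<Otimes>\<^sub>M lborel) (\<lambda>(x, y). indicator {0..1} x * indicator {0..1} y)"
    by (rule pair_measure_density)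
      (auto intro: lborel.sigma_finite_measure_axioms sigma_finite_measure_axioms)
  also have "\<dots> = leb_square"
    unfolding leb_square_def lborel_prod
    by (intro arg_cong[where f = "density lborel"]) (auto simp: indicator_def)
  finally show ?thesis by simp
qed

lemma sets_leb_square [simp, measurable_cong]: "sets leb_square = sets borel"
  by (simp add: leb_square_def)

lemma space_leb_square [simp]: "space leb_square = UNIV"
  by (simp add: leb_square_def)

lemma sets_unif_pair: "sets (unif \<Otimes>\<^sub>M unif) = sets borel"
  unfolding leb_square_eq[symmetric] by simp

lemma prob_space_leb_square: "prob_space leb_square"
proof -
  interpret pair_prob_space unif unif
    by (intro pair_prob_space.intro pair_sigma_finite.intro prob_space_imp_sigma_finite prob_space_unif)
  show ?thesis unfolding leb_square_eq by (rule prob_space_axioms)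
qed

lemma measurable_borel_fst:
  "fst \<in> (borel :: ('a::second_countable_topology \<times> 'b::second_countable_topology) measure) \<rightarrow>\<^sub>M borel"
  by (simp flip: borel_prod)

lemma measurable_borel_snd:
  "snd \<in> (borel :: ('a::second_countable_topology \<times> 'b::second_countable_topology) measure) \<rightarrow>\<^sub>M borel"
  by (simp flip: borel_prod)

lemmas [measurable] =
  measurable_compose[OF _ measurable_borel_fst]
  measurable_compose[OF _ measurable_borel_snd]

lemma distr_leb_square_swap: "distr leb_square borel (\<lambda>p. (snd p, fst p)) = leb_square"
proof -
  interpret prob_space unif by (rule prob_space_unif)
  interpret pair_sigma_finite unif unif ..
  have "distr leb_square borel (\<lambda>p. (snd p, fst p)) = distr leb_square (unif \<Otimes>\<^sub>M unif) (\<lambda>(x, y). (y, x))"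
    by (rule distr_cong) (simp_all only: sets_unif_pair case_prod_beta)
  also have "\<dots> = leb_square"
    unfolding leb_square_eq by (rule distr_pair_swap[symmetric])
  finally show ?thesis .
qed

text \<open>A shear: on each vertical line \<open>bitxor x\<close> preserves the uniform measure, so
  by Fubini the map preserves the measure of rectangles.\<close>

lemma distr_leb_square_bitxor:
  "distr leb_square borel (\<lambda>p. (fst p, bitxor (fst p) (snd p))) = leb_square"
proof -
  interpret prob_space unif by (rule prob_space_unif)
  let ?g = "\<lambda>p. (fst p, bitxor (fst p) (snd p))"
  have [measurable]: "?g \<in> borel \<rightarrow>\<^sub>M borel"
    by measurable
  have "unif \<Otimes>\<^sub>M unif = distr leb_square borel ?g"
  proof (rule pair_measure_eqI)
    show "sets (unif \<Otimes>\<^sub>M unif) = sets (distr leb_square borel ?g)"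
      by (simp only: sets_unif_pair sets_distr)
    fix A B assume "A \<in> sets unif" "B \<in> sets unif"
    then have [measurable]: "A \<in> sets borel" "B \<in> sets borel" by auto
    have AB: "A \<times> B \<in> sets borel" by (rule borel_Times) auto
    have S: "?g -` (A \<times> B) \<in> sets (unif \<Otimes>\<^sub>M unif)"
      using measurable_sets[of ?g borel borel "A \<times> B"] AB by (simp only: sets_unif_pair) simp
    have "emeasure (distr leb_square borel ?g) (A \<times> B) = emeasure (unif \<Otimes>\<^sub>M unif) (?g -` (A \<times> B))"
      using AB by (subst emeasure_distr) (simp_all flip: leb_square_eq)
    also have "\<dots> = (\<integral>\<^sup>+ x. emeasure unif (Pair x -` ?g -` (A \<times> B)) \<partial>unif)"
      by (rule emeasure_pair_measure_alt[OF S])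
    also have "\<dots> = (\<integral>\<^sup>+ x. indicator A x * emeasure unif B \<partial>unif)"
    proof (rule nn_integral_cong)
      fix x
      have "Pair x -` ?g -` (A \<times> B) = (if x \<in> A then bitxor x -` B else {})"
        by auto
      moreover have "emeasure unif (bitxor x -` B) = emeasure unif B"
        by (subst (2) distr_bitxor[of x, symmetric], subst emeasure_distr) auto
      ultimately show "emeasure unif (Pair x -` ?g -` (A \<times> B)) = indicator A x * emeasure unif B"
        by simp
    qed
    also have "\<dots> = emeasure unif A * emeasure unif B"
      by (subst nn_integral_multc) auto
    finally show "emeasure unif A * emeasure unif B = emeasure (distr leb_square borel ?g) (A \<times> B)"
      by simp
  qed (rule sigma_finite_measure_axioms)+
  then show ?thesis by (simp flip: leb_square_eq)
qed

lemma AE_leb_square_fst: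
  assumes "AE x in unif. P x"
  shows "AE p in leb_square. P (fst p)"
proof -
  interpret prob_space unif by (rule prob_space_unif)
  show ?thesis unfolding leb_square_eq
    by (rule AE_distrD[where M' = unif], simp, unfold distr_pair_fst, rule assms)
qed

lemma AE_leb_square:
  "AE p in leb_square. fst p \<in> {0..1} - \<rat> \<and> snd p \<in> {0..1} - \<rat>"
proof -
  have "AE x in lborel. x \<notin> (\<rat> :: real set)"
    by (rule AE_I'[OF countable_imp_null_set_lborel[OF countable_rat]]) auto
  then have "AE x in unif. x \<in> {0..1} - \<rat>"
    by (simp add: AE_density) (auto simp: indicator_def)
  then have 1: "AE p in leb_square. fst p \<in> {0..1} - \<rat>"
    by (rule AE_leb_square_fst)
  \<comment> \<open>Invariance under the swap transfers the statement to the second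
    coordinate.\<close>
  have "(\<lambda>p. (snd p, fst p)) \<in> leb_square \<rightarrow>\<^sub>M borel"
    by measurable
  moreover have "AE p in distr leb_square borel (\<lambda>p. (snd p, fst p)). fst p \<in> {0..1} - \<rat>"
    unfolding distr_leb_square_swap by (rule 1)
  ultimately have "AE p in leb_square. fst (snd p, fst p) \<in> {0..1} - \<rat>"
    by (rule AE_distrD)
  with 1 show ?thesis by eventually_elim auto
qed

section \<open>Optimality\<close>

definition xor_measure :: "point3 measure" where
  "xor_measure = distr leb_square borel (\<lambda>p. (fst p, snd p, bitxor (fst p) (snd p)))"

lemma measurable_xor_graph [measurable]:
  "(\<lambda>p. (fst p, snd p, bitxor (fst p) (snd p))) \<in> borel \<rightarrow>\<^sub>M borel"
  by measurable

lemma Pr_eq: "Pr12 = (\<lambda>p. (fst p, fst (snd p)))" "Pr13 = (\<lambda>p. (fst p, snd (snd p)))"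
  "Pr23 = (\<lambda>p. (fst (snd p), snd (snd p)))"
  by (auto simp: Pr12_def Pr13_def Pr23_def)

lemma measurable_Pr [measurable]:
  "Pr12 \<in> borel \<rightarrow>\<^sub>M borel" "Pr13 \<in> borel \<rightarrow>\<^sub>M borel" "Pr23 \<in> borel \<rightarrow>\<^sub>M borel"
  unfolding Pr_eq by measurable

lemma closed_unit_cube: "closed unit_cube"
  unfolding unit_cube_def by (intro closed_Times closed_atLeastAtMost)

text \<open>The first marginal is immediate, the second is the shear, and the third reduces to the
  shear by swapping the coordinates and commutativity of \<open>bitxor\<close>.\<close>

lemma admissible_xor_measure: "admissible xor_measure"
proof -
  interpret L: prob_space leb_square by (rule prob_space_leb_square)
  have [measurable]: "unit_cube \<in> sets borel"
    using closed_unit_cube by (rule borel_closed)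
  have "AE p in leb_square. (fst p, snd p, bitxor (fst p) (snd p)) \<in> unit_cube"
    using AE_leb_square by eventually_elim (use bitxor_unit in \<open>auto simp: unit_cube_def\<close>)
  then have "AE p in xor_measure. p \<in> unit_cube"
    unfolding xor_measure_def by (subst AE_distr_iff) auto
  then have "emeasure xor_measure (UNIV - unit_cube) = 0"
    using emeasure_eq_0_AE[of "\<lambda>p. p \<notin> unit_cube" xor_measure]
    by (simp add: xor_measure_def set_diff_eq)
  moreover have "distr xor_measure borel Pr12 = leb_square"
    unfolding xor_measure_def
    by (subst distr_distr) (auto simp: o_def Pr_eq distr_id2)
  moreover have "distr xor_measure borel Pr13 = leb_square"
    unfolding xor_measure_def
    by (subst distr_distr) (auto simp: o_def Pr_eq distr_leb_square_bitxor)
  moreover have "distr xor_measure borel Pr23 = leb_square"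
  proof -
    have "distr xor_measure borel Pr23 = distr leb_square borel (\<lambda>p. (snd p, bitxor (fst p) (snd p)))"
      unfolding xor_measure_def by (subst distr_distr) (auto simp: o_def Pr_eq)
    also have "\<dots> = distr (distr leb_square borel (\<lambda>p. (snd p, fst p))) borel (\<lambda>p. (fst p, bitxor (fst p) (snd p)))"
      by (subst distr_distr) (auto simp: o_def bitxor_commute)
    finally show ?thesis by (simp add: distr_leb_square_swap distr_leb_square_bitxor)
  qed
  ultimately show ?thesis
    unfolding admissible_def xor_measure_def by (auto intro: L.prob_space_distr)
qed

lemma AE_admissible:
  assumes "admissible \<pi>"
  shows "AE p in \<pi>. fst p \<in> {0..1} - \<rat> \<and> fst (snd p) \<in> {0..1} - \<rat> \<and> snd (snd p) \<in> {0..1} - \<rat>"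
proof -
  have [measurable_cong]: "sets \<pi> = sets borel" and d: "distr \<pi> borel Pr12 = leb_square" "distr \<pi> borel Pr13 = leb_square"
    using assms by (auto simp: admissible_def)
  let ?P = "\<lambda>p. fst p \<in> {0..1} - \<rat> \<and> snd p \<in> {0..1} - \<rat>"
  \<comment> \<open>These two marginals already cover all three coordinates.\<close>
  have "AE p in \<pi>. ?P (Pr12 p)" "AE p in \<pi>. ?P (Pr13 p)"
    by (rule AE_distrD[where M' = borel], measurable, simp only: d AE_leb_square)+
  then show ?thesis
    by eventually_elim (auto simp: Pr_eq)
qed

section \<open>From costs to integrals of the gap\<close>

definition gap_at :: "point3 \<Rightarrow> real" where
  "gap_at p = gap (fst p) (fst (snd p)) (snd (snd p))"

lemma measurable_gap_at [measurable]: "gap_at \<in> borel_measurable borel"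
  unfolding gap_at_def gap_def by measurable

lemma integrable_gap_at:
  assumes "admissible \<pi>"
  shows "integrable \<pi> gap_at"
proof -
  have [measurable_cong]: "sets \<pi> = sets borel" and "prob_space \<pi>"
    using assms by (auto simp: admissible_def)
  interpret prob_space \<pi> by fact
  show ?thesis
  proof (rule integrable_const_bound[where B = 4])
    show "AE p in \<pi>. norm (gap_at p) \<le> 4"
      using AE_admissible[OF assms] by eventually_elim (auto simp: gap_at_def intro!: gap_bound)
  qed measurable
qed

text \<open>The three potential terms factor through the prescribed marginals, so cost and gap
  integrals differ by a constant common to all admissible measures.\<close>

lemma integral_cost:
  assumes "admissible \<pi>"
  shows "integral\<^sup>L \<pi> cost = integral\<^sup>L \<pi> gap_at + 3 * (LINT p|leb_square. pot (fst p) (snd p))"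
proof -
  have [measurable_cong]: "sets \<pi> = sets borel" and "prob_space \<pi>"
    and d: "distr \<pi> borel Pr12 = leb_square" "distr \<pi> borel Pr13 = leb_square" "distr \<pi> borel Pr23 = leb_square"
    using assms by (auto simp: admissible_def)
  interpret L: prob_space leb_square by (rule prob_space_leb_square)
  let ?f = "\<lambda>p. pot (fst p) (snd p)"
  have f: "integrable leb_square ?f"
  proof (rule L.integrable_const_bound[where B = 1])
    show "AE p in leb_square. norm (?f p) \<le> 1"
      using AE_leb_square by eventually_elim (auto intro!: pot_bound)
  qed measurable
  have I: "integrable \<pi> (\<lambda>p. ?f (P p))" "(LINT p|\<pi>. ?f (P p)) = integral\<^sup>L leb_square ?f"
    if [measurable]: "P \<in> borel \<rightarrow>\<^sub>M borel" and d: "distr \<pi> borel P = leb_square" for P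
  proof -
    have [measurable]: "P \<in> \<pi> \<rightarrow>\<^sub>M borel" by measurable
    show "integrable \<pi> (\<lambda>p. ?f (P p))"
      by (rule integrable_distr[of P \<pi> borel]) (simp_all add: d f)
    show "(LINT p|\<pi>. ?f (P p)) = integral\<^sup>L leb_square ?f"
      unfolding d[symmetric] by (rule integral_distr[symmetric]) measurable
  qed
  note I12 = I[OF measurable_Pr(1) d(1)] and I13 = I[OF measurable_Pr(2) d(2)] and I23 = I[OF measurable_Pr(3) d(3)]
  have "cost = (\<lambda>p. gap_at p + (?f (Pr12 p) + (?f (Pr13 p) + ?f (Pr23 p))))"
    by (auto simp: cost_def gap_at_def gap_def Pr_eq)
  then have "integral\<^sup>L \<pi> cost = (LINT p|\<pi>. gap_at p + (?f (Pr12 p) + (?f (Pr13 p) + ?f (Pr23 p))))"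
    by (rule arg_cong)
  also have "\<dots> = integral\<^sup>L \<pi> gap_at + 3 * integral\<^sup>L leb_square ?f"
    using I12 I13 I23 integrable_gap_at[OF assms]
    by (simp add: Bochner_Integration.integral_add Bochner_Integration.integrable_add)
  finally show ?thesis .
qed

text \<open>If \<open>bitxor x y\<close> is irrational, its \<open>doubling\<close> digits are the
  exclusive ors of the digits of \<open>x\<close> and \<open>y\<close>. Then each doubling step
  multiplies the gap by 8, while the gap stays bounded.\<close>

lemma gap_bitxor:
  assumes "x \<in> {0..1}" "y \<in> {0..1}" "bitxor x y \<notin> \<rat>"
  shows "gap x y (bitxor x y) = 0"
proof -
  let ?P = "\<lambda>(x, y). x \<in> {0..1} \<and> y \<in> {0..1} \<and> bitxor x y \<notin> \<rat>"
  let ?f = "\<lambda>(x, y). gap x y (bitxor x y)"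
  let ?h = "\<lambda>(x, y). (doubling x, doubling y)"
  have "?f (x, y) = (\<lambda>_. 0) (x, y)"
  proof (rule eq_if_halving[where P = ?P and h = ?h and B = 4])
    fix s assume "?P s"
    then obtain x y where s: "s = (x, y)" and P: "x \<in> {0..1}" "y \<in> {0..1}" "bitxor x y \<notin> \<rat>"
      by (cases s) auto
    show "\<bar>?f s - 0\<bar> \<le> 4"
      using gap_bound[OF P(1,2) bitxor_unit] by (simp add: s)
    define z' where "z' = bitxor (doubling x) (doubling y)"
    have z: "bitxor x y = (z' + xor_digit x y) / 2"
      unfolding z'_def by (rule bitxor_rec)
    have x: "xor_digit x y = 0 \<or> xor_digit x y = 1"
      by (simp add: xor_digit_def)
    \<comment> \<open>The only ambiguous case is an exclusive-or digit 0 followed by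
      \<open>z' = 1\<close>, which gives \<open>1/2\<close>.\<close>
    have "bitxor x y \<noteq> 1/2"
      using P(3) by (metis Rats_1 Rats_divide Rats_number_of)
    then have dig: "digit (bitxor x y) = xor_digit x y"
      using bitxor_unit[of "doubling x" "doubling y"] x z unfolding digit_def z'_def by auto
    then have z'_eq: "doubling (bitxor x y) = z'"
      unfolding doubling_def dig using z by argo
    have "z' \<notin> \<rat>"
      using doubling_irrational[OF P(3)] z'_eq by simp
    moreover have "gap x y (bitxor x y) = gap (doubling x) (doubling y) z' / 8"
      using gap_even_digits[OF P(1,2) bitxor_unit dig] z'_eq by simp
    ultimately show "?P (?h s) \<and> \<bar>?f s - 0\<bar> \<le> \<bar>?f (?h s) - 0\<bar> / 2"
      using P doubling_unit by (simp add: s z'_def abs_divide)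
  qed (use assms in auto)
  then show ?thesis by simp
qed

lemma integral_gap_xor_measure: "integral\<^sup>L xor_measure gap_at = 0"
proof -
  have "AE p in xor_measure. snd (snd p) = bitxor (fst p) (fst (snd p))"
    unfolding xor_measure_def by (subst AE_distr_iff) auto
  with AE_admissible[OF admissible_xor_measure] have "AE p in xor_measure. gap_at p = 0"
    by eventually_elim (auto simp: gap_at_def intro!: gap_bitxor)
  then show ?thesis by (rule integral_eq_zero_AE)
qed

lemma integral_gap_nonneg:
  assumes "admissible \<pi>"
  shows "0 \<le> integral\<^sup>L \<pi> gap_at"
proof (rule integral_nonneg_AE)
  show "AE p in \<pi>. 0 \<le> gap_at p"
    using AE_admissible[OF assms] by eventually_elim (auto simp: gap_at_def intro!: gap_nonneg)
qed

text \<open>By \<open>integral_cost\<close> the gap integral is minimized, with minimum 0 attained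
  by \<open>xor_measure\<close>. A nonnegative gap with zero integral vanishes almost everywhere, so
  an optimal measure lives on the graph of \<open>bitxor\<close> and is the image of its first
  marginal.\<close>

lemma optimal_iff: "optimal \<pi> \<longleftrightarrow> \<pi> = xor_measure"
proof
  show "\<pi> = xor_measure \<Longrightarrow> optimal \<pi>"
    using admissible_xor_measure integral_cost integral_gap_xor_measure integral_gap_nonneg
    by (simp add: optimal_def)
next
  assume opt: "optimal \<pi>"
  then have adm: "admissible \<pi>" by (simp add: optimal_def)
  then have s [measurable_cong]: "sets \<pi> = sets borel" and d: "distr \<pi> borel Pr12 = leb_square"
    by (auto simp: admissible_def)
  have "integral\<^sup>L \<pi> cost \<le> integral\<^sup>L xor_measure cost"
    using opt admissible_xor_measure by (simp add: optimal_def)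
  then have "integral\<^sup>L \<pi> gap_at = 0"
    using integral_gap_nonneg[OF adm] integral_gap_xor_measure
    unfolding integral_cost[OF adm] integral_cost[OF admissible_xor_measure] by simp
  moreover have "AE p in \<pi>. 0 \<le> gap_at p"
    using AE_admissible[OF adm] by eventually_elim (auto simp: gap_at_def intro!: gap_nonneg)
  ultimately have "AE p in \<pi>. gap_at p = 0"
    using integral_nonneg_eq_0_iff_AE[OF integrable_gap_at[OF adm]] by simp
  with AE_admissible[OF adm] have graph: "AE p in \<pi>. snd (snd p) = bitxor (fst p) (fst (snd p))"
    by eventually_elim (auto simp: gap_at_def intro!: gap_zero_imp_bitxor)
  have "\<pi> = distr \<pi> borel (\<lambda>p. p)"
    by (rule distr_id2[symmetric]) (simp add: s)
  also have "\<dots> = distr \<pi> borel (\<lambda>p. (fst p, fst (snd p), bitxor (fst p) (fst (snd p))))"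
    by (rule distr_cong_AE) (use graph in \<open>auto elim!: eventually_mono simp: prod_eq_iff\<close>)
  also have "\<dots> = distr (distr \<pi> borel Pr12) borel (\<lambda>p. (fst p, snd p, bitxor (fst p) (snd p)))"
    by (subst distr_distr) (auto simp: o_def Pr_eq)
  also have "\<dots> = xor_measure"
    by (simp add: d xor_measure_def)
  finally show "\<pi> = xor_measure" .
qed

section \<open>The support\<close>

text \<open>The possible leading digits of points of the tetrahedron, which serve as translation
  vectors of the contractions sending \<open>q\<close> to
  \<open>(1/2) *\<^sub>R (s + q)\<close>.\<close>

definition even_bits :: "point3 set" where
  "even_bits = {(0, 0, 0), (1, 1, 0), (1, 0, 1), (0, 1, 1)}"

section \<open>Self-similarity and closedness of the tetrahedron\<close>

lemma suminf_bits_halve: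
  fixes a :: "nat \<Rightarrow> nat"
  assumes "\<And>k. a k \<in> {0, 1}"
  shows "(\<Sum>k. real (a k) / 2 ^ Suc k) = (real (a 0) + (\<Sum>k. real (a (Suc k)) / 2 ^ Suc k)) / 2"
    and "\<bar>\<Sum>k. real (a k) / 2 ^ Suc k\<bar> \<le> 1"
proof -
  have b: "\<bar>real (a k)\<bar> \<le> 1" for k
    using assms[of k] by auto
  show "(\<Sum>k. real (a k) / 2 ^ Suc k) = (real (a 0) + (\<Sum>k. real (a (Suc k)) / 2 ^ Suc k)) / 2"
    using suminf_geometric_shift[of "\<lambda>k. real (a k)" 1 2, OF b] by (simp del: power_Suc)
  show "\<bar>\<Sum>k. real (a k) / 2 ^ Suc k\<bar> \<le> 1"
    using suminf_geometric_bound[of "\<lambda>k. real (a k)" 1 2, OF b] by (simp del: power_Suc)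
qed

lemma sierpinskiI:
  fixes a b c :: "nat \<Rightarrow> nat"
  assumes "\<And>k. a k \<in> {0,1} \<and> b k \<in> {0,1} \<and> c k \<in> {0,1} \<and> even (a k + b k + c k)"
  shows "((\<Sum>k. real (a k) / 2 ^ Suc k),
    (\<Sum>k. real (b k) / 2 ^ Suc k), (\<Sum>k. real (c k) / 2 ^ Suc k)) \<in> sierpinski"
  unfolding sierpinski_def mem_Collect_eq prod.case
  by (rule exI[of _ a], rule exI[of _ b], rule exI[of _ c], rule conjI[OF allI[OF assms]])
    (intro conjI refl)

lemma sierpinskiE:
  assumes "(x, y, z) \<in> sierpinski"
  obtains a b c :: "nat \<Rightarrow> nat"
  where "\<And>k. a k \<in> {0,1} \<and> b k \<in> {0,1} \<and> c k \<in> {0,1} \<and> even (a k + b k + c k)"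
    "x = (\<Sum>k. real (a k) / 2 ^ Suc k)" "y = (\<Sum>k. real (b k) / 2 ^ Suc k)" "z = (\<Sum>k. real (c k) / 2 ^ Suc k)"
  using assms unfolding sierpinski_def mem_Collect_eq prod.case by (elim exE conjE) blast

text \<open>Removing the leading digits leaves three expansions whose digit sums are still
  even.\<close>

lemma sierpinski_halve:
  assumes "p \<in> sierpinski"
  shows "\<exists>s\<in>even_bits. \<exists>q\<in>sierpinski. p = (1/2) *\<^sub>R (s + q)"
proof -
  define v where "v a = (\<Sum>k. real (a k) / 2 ^ Suc k)" for a :: "nat \<Rightarrow> nat"
  obtain x y z where xyz: "p = (x, y, z)" by (cases p) auto
  obtain a b c where abc: "\<And>k. a k \<in> {0,1} \<and> b k \<in> {0,1} \<and> c k \<in> {0,1} \<and> even (a k + b k + c k)"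
    and "x = v a" "y = v b" "z = v c"
    by (rule sierpinskiE[OF assms[unfolded xyz], folded v_def]) (rule that; assumption)
  then have p: "p = (v a, v b, v c)"
    by (simp add: xyz)
  let ?t = "\<lambda>a k. a (Suc k) :: nat"
  have "v a = (real (a 0) + v (?t a)) / 2" "v b = (real (b 0) + v (?t b)) / 2" "v c = (real (c 0) + v (?t c)) / 2"
    unfolding v_def by (rule suminf_bits_halve(1), use abc in blast)+
  then have "p = (1/2) *\<^sub>R ((real (a 0), real (b 0), real (c 0)) + (v (?t a), v (?t b), v (?t c)))"
    by (simp add: p)
  moreover have "(v (?t a), v (?t b), v (?t c)) \<in> sierpinski"
    unfolding v_def by (rule sierpinskiI) (rule abc)
  moreover have "(real (a 0), real (b 0), real (c 0)) \<in> even_bits"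
    using abc[of 0] by (auto simp: even_bits_def)
  ultimately show ?thesis by blast
qed

lemma sierpinski_bound:
  assumes "(x, y, z) \<in> sierpinski"
  shows "\<bar>x\<bar> \<le> 1" "\<bar>y\<bar> \<le> 1" "\<bar>z\<bar> \<le> 1"
  by (rule sierpinskiE[OF assms], simp only:, rule suminf_bits_halve(2), blast)+

lemma bounded_sierpinski: "bounded sierpinski"
proof (rule bounded_subset)
  show "bounded ({-1..1::real} \<times> {-1..1::real} \<times> {-1..1::real})"
    by (intro bounded_Times bounded_closed_interval)
  show "sierpinski \<subseteq> {-1..1} \<times> {-1..1} \<times> {-1..1}"
  proof
    fix p assume p: "p \<in> sierpinski"
    obtain x y z where "p = (x, y, z)" by (cases p) auto
    then show "p \<in> {-1..1} \<times> {-1..1} \<times> {-1..1}"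
      using sierpinski_bound[of x y z] p by (auto simp: abs_le_iff)
  qed
qed

text \<open>The digit series along the orbit of \<open>h\<close> solves the same recursion as
  \<open>\<phi>\<close>, and bounded solutions are unique.\<close>

lemma binary_expansion:
  fixes \<phi> d :: "'a \<Rightarrow> real"
  assumes step: "\<And>p. p \<in> R \<Longrightarrow> h p \<in> R \<and> \<phi> p = (d p + \<phi> (h p)) / 2"
    and d: "\<And>p. \<bar>d p\<bar> \<le> 1" and B: "\<And>p. p \<in> R \<Longrightarrow> \<bar>\<phi> p\<bar> \<le> B" and "p \<in> R"
  shows "\<phi> p = (\<Sum>n. d ((h ^^ n) p) / 2 ^ Suc n)"
proof (rule eq_if_halving[where P = "\<lambda>p. p \<in> R" and h = h and B = "B + 1" and
      g = "\<lambda>p. \<Sum>n. d ((h ^^ n) p) / 2 ^ Suc n"])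
  let ?g = "\<lambda>p. \<Sum>n. d ((h ^^ n) p) / 2 ^ Suc n"
  fix p assume p: "p \<in> R"
  show "\<bar>\<phi> p - ?g p\<bar> \<le> B + 1"
    using B[OF p] suminf_geometric_bound[of "\<lambda>n. d ((h ^^ n) p)" 1 2, OF d] by (simp del: power_Suc)
  have "2 * ?g p = d p + ?g (h p)"
    using suminf_geometric_shift[of "\<lambda>n. d ((h ^^ n) p)" 1 2, OF d] by (simp add: funpow_swap1 del: power_Suc)
  then have "\<phi> p - ?g p = (\<phi> (h p) - ?g (h p)) / 2"
    using step[OF p] by (simp del: power_Suc)
  then have E: "\<bar>\<phi> p - ?g p\<bar> = \<bar>\<phi> (h p) - ?g (h p)\<bar> / 2"
    by (simp only: abs_divide abs_numeral)
  show "h p \<in> R \<and> \<bar>\<phi> p - ?g p\<bar> \<le> \<bar>\<phi> (h p) - ?g (h p)\<bar> / 2"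
    by (rule conjI[OF conjunct1[OF step[OF p]] eq_refl[OF E]])
qed (rule assms)

text \<open>The tetrahedron is the largest bounded set covered by its images under the four
  contractions.\<close>

lemma sierpinski_coinduct:
  assumes "bounded R" and step: "\<And>p. p \<in> R \<Longrightarrow> \<exists>s\<in>even_bits. \<exists>q\<in>R. p = (1/2) *\<^sub>R (s + q)"
  shows "R \<subseteq> sierpinski"
proof
  fix p assume p: "p \<in> R"
  \<comment> \<open>One choice of \<open>s\<close> and \<open>h\<close> serves all three
    coordinates, so digits at equal positions come from the same element of \<open>even_bits\<close>
    and have even sum.\<close>
  from step obtain s h where sh: "\<And>p. p \<in> R \<Longrightarrow> s p \<in> even_bits \<and> h p \<in> R \<and> p = (1/2) *\<^sub>R (s p + h p)"
    by metis
  obtain B where B: "\<And>p. p \<in> R \<Longrightarrow> norm p \<le> B"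
    using \<open>bounded R\<close> bounded_iff by blast
  have iter: "(h ^^ n) p \<in> R" for n
    by (induction n) (use p sh in auto)
  have expand: "\<exists>a. (\<forall>k. a k \<in> {0, 1} \<and> real (a k) = c (s ((h ^^ k) p))) \<and> c p = (\<Sum>k. real (a k) / 2 ^ Suc k)"
    if lin: "\<And>x y. c ((1/2) *\<^sub>R (x + y)) = (c x + c y) / 2" and nrm: "\<And>x. \<bar>c x\<bar> \<le> norm x"
      and bits: "\<And>s. s \<in> even_bits \<Longrightarrow> c s \<in> {0, 1}" for c :: "point3 \<Rightarrow> real"
  proof -
    define d :: "point3 \<Rightarrow> nat" where "d p = (if c (s p) = 1 then 1 else 0)" for p
    have d: "real (d p) = c (s p)" if "p \<in> R" for p
      using bits[of "s p"] sh[OF that] by (auto simp: d_def)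
    have "c p = (\<Sum>k. real (d ((h ^^ k) p)) / 2 ^ Suc k)"
    proof (rule binary_expansion[where R = R and B = B])
      fix p assume p: "p \<in> R"
      show "h p \<in> R \<and> c p = (real (d p) + c (h p)) / 2"
        using sh[OF p] lin[of "s p" "h p"] d[OF p] by metis
      show "\<bar>c p\<bar> \<le> B"
        using nrm[of p] B[OF p] by simp
    qed (use p in \<open>auto simp: d_def\<close>)
    then show ?thesis
      using d[OF iter] by (intro exI[of _ "\<lambda>k. d ((h ^^ k) p)"]) (auto simp: d_def)
  qed
  have n: "\<bar>fst x\<bar> \<le> norm x" "\<bar>fst (snd x)\<bar> \<le> norm x" "\<bar>snd (snd x)\<bar> \<le> norm x" for x :: point3
  proof -
    obtain u v w where x: "x = (u, v, w)" by (cases x) auto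
    show "\<bar>fst x\<bar> \<le> norm x" "\<bar>fst (snd x)\<bar> \<le> norm x" "\<bar>snd (snd x)\<bar> \<le> norm x"
      using norm_fst_le[of u "(v, w)"] norm_snd_le[of "(v, w)" u] norm_fst_le[of v w] norm_snd_le[of w v]
      by (simp_all add: x)
  qed
  have bits: "fst s \<in> {0, 1}" "fst (snd s) \<in> {0, 1}" "snd (snd s) \<in> {0, 1}" if "s \<in> even_bits" for s
    using that by (auto simp: even_bits_def)
  have "\<exists>a. (\<forall>k. a k \<in> {0, 1} \<and> real (a k) = fst (s ((h ^^ k) p))) \<and> fst p = (\<Sum>k. real (a k) / 2 ^ Suc k)"
    by (rule expand[where c = "fst"]) (use n(1) bits(1) in simp_all)
  then obtain a where a: "\<And>k. a k \<in> {0, 1} \<and> real (a k) = fst (s ((h ^^ k) p))" "fst p = (\<Sum>k. real (a k) / 2 ^ Suc k)"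
    by blast
  have "\<exists>b. (\<forall>k. b k \<in> {0, 1} \<and> real (b k) = fst (snd (s ((h ^^ k) p)))) \<and>
      fst (snd p) = (\<Sum>k. real (b k) / 2 ^ Suc k)"
    by (rule expand[where c = "\<lambda>x. fst (snd x)"]) (use n(2) bits(2) in simp_all)
  then obtain b where b: "\<And>k. b k \<in> {0, 1} \<and> real (b k) = fst (snd (s ((h ^^ k) p)))"
    "fst (snd p) = (\<Sum>k. real (b k) / 2 ^ Suc k)"
    by blast
  have "\<exists>c. (\<forall>k. c k \<in> {0, 1} \<and> real (c k) = snd (snd (s ((h ^^ k) p)))) \<and>
      snd (snd p) = (\<Sum>k. real (c k) / 2 ^ Suc k)"
    by (rule expand[where c = "\<lambda>x. snd (snd x)"]) (use n(3) bits(3) in simp_all)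
  then obtain c where c: "\<And>k. c k \<in> {0, 1} \<and> real (c k) = snd (snd (s ((h ^^ k) p)))"
    "snd (snd p) = (\<Sum>k. real (c k) / 2 ^ Suc k)"
    by blast
  have "a k \<in> {0, 1} \<and> b k \<in> {0, 1} \<and> c k \<in> {0, 1} \<and> even (a k + b k + c k)" for k
    using sh[OF iter[of k]] a(1)[of k] b(1)[of k] c(1)[of k] unfolding even_bits_def by auto
  then have "(fst p, fst (snd p), snd (snd p)) \<in> sierpinski"
    unfolding a(2) b(2) c(2) by (rule sierpinskiI)
  then show "p \<in> sierpinski" by simp
qed

text \<open>The images of the closure under the four contractions form a closed set that contains
  the tetrahedron, hence its closure. So the closure covers itself and coinduction applies.\<close>

lemma closed_sierpinski: "closed sierpinski"
proof -
  let ?C = "closure sierpinski"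
  let ?U = "\<Union>s\<in>even_bits. (\<lambda>q. (1/2) *\<^sub>R (s + q)) ` ?C"
  have "compact ?C"
    using bounded_sierpinski by (simp add: compact_closure)
  then have "closed ((\<lambda>q. (1/2) *\<^sub>R (s + q)) ` ?C)" for s
    by (intro compact_imp_closed compact_continuous_image continuous_intros)
  then have "closed ?U"
    by (intro closed_UN) (auto simp: even_bits_def)
  moreover have "sierpinski \<subseteq> ?U"
    using sierpinski_halve closure_subset by fast
  ultimately have "?C \<subseteq> ?U"
    by (simp add: closure_minimal)
  have "?C \<subseteq> sierpinski"
  proof (rule sierpinski_coinduct)
    show "bounded ?C" by (rule bounded_closure[OF bounded_sierpinski])
    show "\<exists>s\<in>even_bits. \<exists>q\<in>?C. p = (1/2) *\<^sub>R (s + q)" if "p \<in> ?C" for p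
      using that \<open>?C \<subseteq> ?U\<close> by blast
  qed
  then show ?thesis
    using closure_subset_eq by blast
qed

text \<open>The recursion of \<open>bitxor\<close> shows that its graph over the unit square is
  covered by its own four images.\<close>

lemma bitxor_sierpinski:
  assumes "x \<in> {0..1}" "y \<in> {0..1}"
  shows "(x, y, bitxor x y) \<in> sierpinski"
proof -
  let ?R = "{(x, y, bitxor x y) |x y. x \<in> {0..1} \<and> y \<in> {0..1}}"
  have "?R \<subseteq> sierpinski"
  proof (rule sierpinski_coinduct)
    show "bounded ?R"
    proof (rule bounded_subset)
      show "bounded ({0..1::real} \<times> {0..1::real} \<times> {0..1::real})"
        by (intro bounded_Times bounded_closed_interval)
      show "?R \<subseteq> {0..1} \<times> {0..1} \<times> {0..1}"
        using bitxor_unit by auto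
    qed
    fix p assume "p \<in> ?R"
    then obtain x y where p: "p = (x, y, bitxor x y)" and xy: "x \<in> {0..1}" "y \<in> {0..1}"
      by blast
    have "p = (1/2) *\<^sub>R ((digit x, digit y, xor_digit x y) + (doubling x, doubling y, bitxor (doubling x) (doubling y)))"
      using bitxor_rec[of x y] eq_half_digit_doubling[of x] eq_half_digit_doubling[of y]
      by (simp add: p add.commute)
    moreover have "(digit x, digit y, xor_digit x y) \<in> even_bits"
      using digit_cases[of x] digit_cases[of y] by (auto simp: even_bits_def xor_digit_def)
    moreover have "(doubling x, doubling y, bitxor (doubling x) (doubling y)) \<in> ?R"
      using xy doubling_unit by blast
    ultimately show "\<exists>s\<in>even_bits. \<exists>q\<in>?R. p = (1/2) *\<^sub>R (s + q)"
      by blast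
  qed
  then show ?thesis using assms by blast
qed

section \<open>The two inclusions between support and tetrahedron\<close>

lemma msupport_xor_measure_subset:
  "msupport xor_measure \<subseteq> sierpinski"
proof (rule ccontr)
  assume "\<not> ?thesis"
  then obtain p where p: "p \<in> msupport xor_measure" "p \<notin> sierpinski" by blast
  then obtain e where e: "e > 0" "ball p e \<subseteq> - sierpinski"
    using closed_sierpinski open_contains_ball[of "- sierpinski"] by (auto simp: closed_def)
  have [measurable]: "sierpinski \<in> sets borel"
    using closed_sierpinski by (rule borel_closed)
  have "AE p in leb_square. (fst p, snd p, bitxor (fst p) (snd p)) \<in> sierpinski"
    using AE_leb_square by eventually_elim (auto intro: bitxor_sierpinski)
  then have "AE p in xor_measure. p \<in> sierpinski"
    unfolding xor_measure_def by (subst AE_distr_iff) auto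
  then have "AE q in xor_measure. q \<notin> ball p e"
    by eventually_elim (use e in auto)
  then have "emeasure xor_measure {q \<in> space xor_measure. q \<in> ball p e} = 0"
    by (rule emeasure_eq_0_AE)
  moreover have "{q \<in> space xor_measure. q \<in> ball p e} = ball p e"
    by (auto simp: xor_measure_def)
  ultimately have "emeasure xor_measure (ball p e) = 0"
    by (simp only:)
  then show False
    using p(1) e(1) by (force simp: msupport_def)
qed

text \<open>Prescribing the first \<open>n\<close> digits of \<open>x\<close> and \<open>y\<close>
  to be those of an expansion of \<open>p\<close> confines them to a dyadic box, and forces the
  digits of \<open>bitxor x y\<close> as well. Only the box in the first two coordinates matters for
  the measure.\<close>

lemma sierpinski_box:
  assumes "p \<in> sierpinski"
  shows "\<exists>\<alpha> \<beta> \<gamma> \<delta>. 0 \<le> \<alpha> \<and> \<alpha> < \<beta> \<and> \<beta> \<le> 1 \<and> 0 \<le> \<gamma> \<and> \<gamma> < \<delta> \<and> \<delta> \<le> 1 \<and>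
    (\<forall>x\<in>{\<alpha><..<\<beta>}. \<forall>y\<in>{\<gamma><..<\<delta>}. dist (x, y, bitxor x y) p \<le> 6 * (1 / 2) ^ n)"
  using assms
proof (induction n arbitrary: p)
  case 0
  have "dist (x, y, bitxor x y) p \<le> 6" if "x \<in> {0<..<1}" "y \<in> {0<..<1}" for x y
  proof -
    obtain u v w where p: "p = (u, v, w)" by (cases p) auto
    have "dist (x, y, bitxor x y) p \<le> \<bar>x - u\<bar> + (\<bar>y - v\<bar> + \<bar>bitxor x y - w\<bar>)"
      using norm_Pair_le[of "x - u" "(y - v, bitxor x y - w)"] norm_Pair_le[of "y - v" "bitxor x y - w"]
      by (simp add: p dist_norm)
    \<comment> \<open>Coordinates of points of the tetrahedron are known to lie in [-1,1], so each
      difference is at most 2.\<close>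
    also have "\<dots> \<le> 6"
      using sierpinski_bound[of u v w] 0 that bitxor_unit[of x y] by (auto simp: p)
    finally show ?thesis .
  qed
  then show ?case
    by (intro exI[of _ 0] exI[of _ 1]) auto
next
  case (Suc n)
  obtain s q where s: "s \<in> even_bits" and q: "q \<in> sierpinski" and p: "p = (1/2) *\<^sub>R (s + q)"
    using sierpinski_halve[OF Suc.prems] by blast
  obtain \<alpha> \<beta> \<gamma> \<delta> where ab: "0 \<le> \<alpha>" "\<alpha> < \<beta>" "\<beta> \<le> 1" "0 \<le> \<gamma>" "\<gamma> < \<delta>" "\<delta> \<le> 1"
    and box: "\<And>x y. x \<in> {\<alpha><..<\<beta>} \<Longrightarrow> y \<in> {\<gamma><..<\<delta>} \<Longrightarrow> dist (x, y, bitxor x y) q \<le> 6 * (1 / 2) ^ n"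
    using Suc.IH[OF q] by blast
  obtain a b c where abc: "s = (a, b, c)" by (cases s) auto
  have bits: "a = 0 \<or> a = 1" "b = 0 \<or> b = 1" "c = (if a = b then 0 else 1)"
    using s by (auto simp: abc even_bits_def)
  have "dist (x, y, bitxor x y) p \<le> 6 * (1 / 2) ^ Suc n"
    if x: "x \<in> {(\<alpha> + a) / 2<..<(\<beta> + a) / 2}" and y: "y \<in> {(\<gamma> + b) / 2<..<(\<delta> + b) / 2}" for x y
  proof -
    \<comment> \<open>Open intervals matter: for \<open>a = 0\<close> and \<open>\<beta> = 1\<close>
      they exclude \<open>x = 1/2\<close>, whose digit is 1.\<close>
    have d: "digit x = a" "digit y = b"
      using x y ab bits unfolding digit_def by auto
    then have "doubling x \<in> {\<alpha><..<\<beta>}" "doubling y \<in> {\<gamma><..<\<delta>}"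
      using x y by (auto simp: doubling_def)
    then have "dist (doubling x, doubling y, bitxor (doubling x) (doubling y)) q \<le> 6 * (1 / 2) ^ n"
      by (rule box)
    moreover have "(x, y, bitxor x y) = (1/2) *\<^sub>R (s + (doubling x, doubling y, bitxor (doubling x) (doubling y)))"
      using bitxor_rec[of x y] eq_half_digit_doubling[of x] eq_half_digit_doubling[of y] bits(3)
      unfolding abc xor_digit_def d by (simp add: add.commute)
    ultimately show ?thesis
      unfolding p by (simp add: dist_norm flip: scaleR_diff_right)
  qed
  then show ?case
    using ab bits
    by (intro exI[of _ "(\<alpha> + a) / 2"] exI[of _ "(\<beta> + a) / 2"] exI[of _ "(\<gamma> + b) / 2"] exI[of _ "(\<delta> + b) / 2"])
      auto
qed

text \<open>A box from \<open>sierpinski_box\<close> has positive area, and for large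
  \<open>n\<close> the graph over it lies in the given ball.\<close>

lemma sierpinski_subset_msupport:
  "sierpinski \<subseteq> msupport xor_measure"
proof
  fix p assume p: "p \<in> sierpinski"
  have "0 < emeasure xor_measure (ball p e)" if e: "e > 0" for e
  proof -
    have "(\<lambda>n. 6 * (1 / 2) ^ n) \<longlonglongrightarrow> (0::real)"
      by (intro tendsto_mult_right_zero LIMSEQ_power_zero) auto
    then obtain n where n: "6 * (1 / 2) ^ n < e"
      using e by (metis (no_types, lifting) eventually_sequentially order_refl order_tendstoD(2))
    obtain \<alpha> \<beta> \<gamma> \<delta> where ab: "0 \<le> \<alpha>" "\<alpha> < \<beta>" "\<beta> \<le> 1" "0 \<le> \<gamma>" "\<gamma> < \<delta>" "\<delta> \<le> 1"
      and box: "\<And>x y. x \<in> {\<alpha><..<\<beta>} \<Longrightarrow> y \<in> {\<gamma><..<\<delta>} \<Longrightarrow> dist (x, y, bitxor x y) p \<le> 6 * (1 / 2) ^ n"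
      using sierpinski_box[OF p] by blast
    interpret prob_space unif by (rule prob_space_unif)
    have I: "emeasure unif {l<..<u} = ennreal (u - l)" if "0 \<le> l" "l < u" "u \<le> 1" for l u
    proof -
      have "emeasure unif {l<..<u} = (\<integral>\<^sup>+ x. indicator {l<..<u} x \<partial>lborel)"
        by (subst emeasure_density, simp, simp, rule nn_integral_cong)
          (use that in \<open>auto split: split_indicator\<close>)
      then show ?thesis using that by simp
    qed
    have "emeasure leb_square ({\<alpha><..<\<beta>} \<times> {\<gamma><..<\<delta>}) = ennreal (\<beta> - \<alpha>) * ennreal (\<delta> - \<gamma>)"
      unfolding leb_square_eq by (subst emeasure_pair_measure_Times) (use ab I in auto)
    then have "0 < emeasure leb_square ({\<alpha><..<\<beta>} \<times> {\<gamma><..<\<delta>})"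
      using ab by (simp flip: ennreal_mult)
    also have "\<dots> \<le> emeasure leb_square ((\<lambda>p. (fst p, snd p, bitxor (fst p) (snd p))) -` ball p e)"
    proof (rule emeasure_mono)
      show "{\<alpha><..<\<beta>} \<times> {\<gamma><..<\<delta>} \<subseteq> (\<lambda>p. (fst p, snd p, bitxor (fst p) (snd p))) -` ball p e"
        using box n by (force simp: dist_commute)
      show "(\<lambda>p. (fst p, snd p, bitxor (fst p) (snd p))) -` ball p e \<in> sets leb_square"
        using measurable_sets[OF measurable_xor_graph, of "ball p e"] by simp
    qed
    also have "\<dots> = emeasure xor_measure (ball p e)"
      unfolding xor_measure_def by (subst emeasure_distr) auto
    finally show ?thesis .
  qed
  then show "p \<in> msupport xor_measure"
    by (simp add: msupport_def)
qed

theorem mainTheorem17: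
  shows "(\<exists>!\<pi>. optimal \<pi>) \<and> (\<forall>\<pi>. optimal \<pi> \<longrightarrow> msupport \<pi> = sierpinski)"
  using optimal_iff msupport_xor_measure_subset sierpinski_subset_msupport by auto

end
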